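(* Let $\mathcal{T}=(P,Q,\epsilon_1,\epsilon_2)$ be a Pultr template such that $P=\vec P_0$ or $P=\vec P_1$, and $Q$ is a tree. Then there exists a digraph functor $\Omega_{\mathcal{T}}$ such that for any digraphs $G,H$ we have $\Gamma_{\mathcal{T}}(G)\to H$ if and only if $G\to\Omega_{\mathcal{T}}(H)$.
   Context: A digraph $G$ is a finite vertex set $V(G)$ (possibly empty) with an arc set $A(G)\subseteq V(G)\times V(G)$ (loops allowed). A homomorphism is an arc-preserving map of vertices; $G\to H$ means that a homomorphism of $G$ to $H$ exists. A tree is a digraph obtained by orienting each edge of a (nonempty, finite) undirected tree in exactly one direction. $\vec P_0$ is the digraph with one vertex and no arcs; $\vec P_1=(\{0,1\},\{(0,1)\})$ is a single arc. A digraph functor is a construction $\Omega$ assigning a digraph $\Omega(G)$ to every digraph $G$ such that $G\to H$ implies $\Omega(G)\to\Omega(H)$. A Pultr template is a quadruple $\mathcal{T}=(P,Q,\epsilon_1,\epsilon_2)$ where $P,Q$ are digraphs and $\epsilon_1,\epsilon_2$ are homomorphisms of $P$ to $Q$. The central Pultr functor $\Gamma_{\mathcal{T}}$ is defined as follows: for a digraph $H$, the vertices of $\Gamma_{\mathcal{T}}(H)$ are the homomorphisms $g:P\to H$, and the arcs are the couples $(g_1,g_2)$ for which there exists a homomorphism $h:Q\to H$ with $g_1=h\circ\epsilon_1$ and $g_2=h\circ\epsilon_2$. *)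

theory Defs
  imports
    "Graph_Theory.Graph_Theory"
    "HOL-Library.FuncSet"
    "HOL-Library.Infinite_Typeclass"
begin

text \<open>
  A digraph is a \<^typ>\<open>'a pair_pre_digraph\<close> satisfying \<^const>\<open>pair_fin_digraph\<close>: a finite,
  possibly empty vertex set and a set of ordered pairs of vertices, loops being allowed.

  Homomorphisms are taken to be extensional, so that they correspond one-to-one to maps defined
  on the vertex set only; in particular there are finitely many of them.
\<close>

definition homs :: "'a pair_pre_digraph \<Rightarrow> 'b pair_pre_digraph \<Rightarrow> ('a \<Rightarrow> 'b) set" where
  "homs G H = {f \<in> pverts G \<rightarrow>\<^sub>E pverts H. \<forall>(u, v) \<in> parcs G. (f u, f v) \<in> parcs H}"

definition hom_to :: "'a pair_pre_digraph \<Rightarrow> 'b pair_pre_digraph \<Rightarrow> bool" where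
  "hom_to G H \<longleftrightarrow> homs G H \<noteq> {}"

definition dipath0 :: "nat pair_pre_digraph" where
  "dipath0 = \<lparr>pverts = {0}, parcs = {}\<rparr>"

definition dipath1 :: "nat pair_pre_digraph" where
  "dipath1 = \<lparr>pverts = {0, 1}, parcs = {(0, 1)}\<rparr>"

text \<open>
  Undirected (simple, finite) graphs are the symmetric loopless digraphs, \<^const>\<open>pair_graph\<close>.
  Every edge gives a closed walk of length 2 there, which is a cycle in the sense of
  \<^const>\<open>pre_digraph.cycle\<close>; the cycles of the undirected graph are those of length at least 3.
  The constant \<^const>\<open>tree\<close> of the library only excludes directed cycles and is therefore
  not the notion needed here. Nonemptiness is part of \<^const>\<open>connected\<close>.
\<close>

definition undirected_tree :: "'a pair_pre_digraph \<Rightarrow> bool" where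
  "undirected_tree T \<longleftrightarrow>
     pair_graph T \<and> connected (with_proj T) \<and>
     \<not> (\<exists>p. pre_digraph.cycle (with_proj T) p \<and> 3 \<le> length p)"

definition orientation_of :: "'a pair_pre_digraph \<Rightarrow> 'a pair_pre_digraph \<Rightarrow> bool" where
  "orientation_of Q T \<longleftrightarrow>
     pverts Q = pverts T \<and> parcs Q \<subseteq> parcs T \<and>
     (\<forall>(u, v) \<in> parcs T. (u, v) \<in> parcs Q \<longleftrightarrow> (v, u) \<notin> parcs Q)"

definition oriented_tree :: "'a pair_pre_digraph \<Rightarrow> bool" where
  "oriented_tree Q \<longleftrightarrow> (\<exists>T. undirected_tree T \<and> orientation_of Q T)"

text \<open>
  The vertices of all digraphs are drawn from the type \<open>'v\<close>. Every digraph is isomorphic to one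
  on \<open>'v\<close> as soon as this type is infinite.
\<close>

definition digraph_functor :: "('v pair_pre_digraph \<Rightarrow> 'v pair_pre_digraph) \<Rightarrow> bool" where
  "digraph_functor \<Omega> \<longleftrightarrow>
     (\<forall>G. pair_fin_digraph G \<longrightarrow> pair_fin_digraph (\<Omega> G)) \<and>
     (\<forall>G H. pair_fin_digraph G \<longrightarrow> pair_fin_digraph H \<longrightarrow> hom_to G H \<longrightarrow> hom_to (\<Omega> G) (\<Omega> H))"

definition pultr_template ::
  "'p pair_pre_digraph \<Rightarrow> 'q pair_pre_digraph \<Rightarrow> ('p \<Rightarrow> 'q) \<Rightarrow> ('p \<Rightarrow> 'q) \<Rightarrow> bool" where
  "pultr_template P Q \<epsilon>\<^sub>1 \<epsilon>\<^sub>2 \<longleftrightarrow>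
     pair_fin_digraph P \<and> pair_fin_digraph Q \<and> \<epsilon>\<^sub>1 \<in> homs P Q \<and> \<epsilon>\<^sub>2 \<in> homs P Q"

text \<open>
  \<^term>\<open>compose (pverts P) h \<epsilon>\<close> is \<^term>\<open>h \<circ> \<epsilon>\<close> restricted to the vertices of \<^term>\<open>P\<close>.
\<close>

definition central_pultr ::
  "'p pair_pre_digraph \<Rightarrow> 'q pair_pre_digraph \<Rightarrow> ('p \<Rightarrow> 'q) \<Rightarrow> ('p \<Rightarrow> 'q) \<Rightarrow>
   'v pair_pre_digraph \<Rightarrow> ('p \<Rightarrow> 'v) pair_pre_digraph" where
  "central_pultr P Q \<epsilon>\<^sub>1 \<epsilon>\<^sub>2 H =
     \<lparr>pverts = homs P H,
      parcs = {(g1, g2). g1 \<in> homs P H \<and> g2 \<in> homs P H \<and>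
        (\<exists>h \<in> homs Q H. g1 = compose (pverts P) h \<epsilon>\<^sub>1 \<and> g2 = compose (pverts P) h \<epsilon>\<^sub>2)}\<rparr>"

lemma pair_fin_digraph_central_pultr:
  assumes "pair_fin_digraph P" "pair_fin_digraph H"
  shows "pair_fin_digraph (central_pultr P Q \<epsilon>\<^sub>1 \<epsilon>\<^sub>2 H)"
proof -
  have fin: "finite (homs P H)"
    by (rule finite_subset[of _ "pverts P \<rightarrow>\<^sub>E pverts H"])
      (use assms in \<open>auto simp: homs_def pair_fin_digraph.pair_finite_verts intro!: finite_PiE\<close>)
  moreover have "parcs (central_pultr P Q \<epsilon>\<^sub>1 \<epsilon>\<^sub>2 H) \<subseteq> homs P H \<times> homs P H"
    by (auto simp: central_pultr_def)
  ultimately have "finite (parcs (central_pultr P Q \<epsilon>\<^sub>1 \<epsilon>\<^sub>2 H))"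
    by (blast intro: finite_subset)
  with fin show ?thesis
    by unfold_locales (auto simp: central_pultr_def)
qed

end

theory Submission
  imports Defs
begin

text \<open>
  A homomorphism from \<open>\<Gamma>(G)\<close> to \<open>H\<close> is a labelling of the vertices (if \<open>P\<close> is a single vertex) or
  of the arcs (if \<open>P\<close> is a single arc) of \<open>G\<close> by vertices of \<open>H\<close>, such that the labels seen along
  every copy of \<open>Q\<close> in \<open>G\<close> satisfy a prescribed condition. Such a condition can be stripped of the
  leaves of \<open>Q\<close> one at a time: enrich the label of a vertex by a set containing the pairs of labels
  (neighbour, connecting arc) that occur around it. Containment is a condition on single arcs, and
  a copy of \<open>Q\<close> minus a leaf is then tested against all pairs stored at the vertex to which the
  leaf was attached. When \<open>Q\<close> is reduced to one vertex only conditions on vertices and arcs remain,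
  and these describe the homomorphisms to a finite digraph.
\<close>

section \<open>Oriented trees built by adding pendant vertices\<close>

text \<open>Trees are encoded inductively so that rule induction removes a leaf \<open>c\<close>
  together with its arc \<open>e\<close>; \<open>p\<close> is the vertex to which the leaf was
  attached.\<close>

inductive pendant_tree :: "'a set \<Rightarrow> ('a \<times> 'a) set \<Rightarrow> bool" where
  single: "pendant_tree {r} {}"
| pendant: "pendant_tree S A \<Longrightarrow> p \<in> S \<Longrightarrow> c \<notin> S \<Longrightarrow> e = (p, c) \<or> e = (c, p) \<Longrightarrow>
    pendant_tree (insert c S) (insert e A)"

lemma pendant_tree_arcs: "pendant_tree S A \<Longrightarrow> A \<subseteq> S \<times> S"
  by (induction rule: pendant_tree.induct) auto

lemma pawalk_verts_snoc: "pcas u q v \<Longrightarrow> pawalk_verts u (q @ [(v, w)]) = pawalk_verts u q @ [w]"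
  by (induction q arbitrary: u) auto

lemma pcas_snoc: "pcas u q v \<Longrightarrow> pcas u (q @ [(v, w)]) w"
  by (induction q arbitrary: u) auto

lemma oriented_tree_pendant_tree:
  assumes "oriented_tree Q"
  shows "pendant_tree (pverts Q) (parcs Q)"
proof -
  obtain T where T: "undirected_tree T" and or: "orientation_of Q T"
    using assms by (auto simp: oriented_tree_def)
  interpret pair_graph T
    using T by (simp add: undirected_tree_def)
  have conn: "connected (with_proj T)"
    and acyc: "\<And>q. cycle q \<Longrightarrow> length q < 3"
    using T by (auto simp: undirected_tree_def not_le)
  have sym: "(v, u) \<in> parcs T" if "(u, v) \<in> parcs T" for u v
    using that by (rule arcs_symmetric)
  have irr: "(u, u) \<notin> parcs T" for u
    using pair_no_loops[of "(u, u)"] by auto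
  define A where "A S = parcs Q \<inter> S \<times> S" for S
  have QT: "pverts Q = pverts T" "parcs Q \<subseteq> parcs T"
    and QT1: "\<And>u v. (u, v) \<in> parcs T \<Longrightarrow> (u, v) \<in> parcs Q \<longleftrightarrow> (v, u) \<notin> parcs Q"
    using or by (auto simp: orientation_of_def)
  text \<open>Grow a subtree from a single vertex; a new vertex with two neighbours in the connected
    set \<open>S\<close> would close a cycle.\<close>
  define grown where "grown S \<longleftrightarrow> S \<noteq> {} \<and> S \<subseteq> pverts T \<and> pendant_tree S (A S) \<and>
    (\<forall>u\<in>S. \<forall>v\<in>S. \<exists>q. apath u q v \<and> set (pawalk_verts u q) \<subseteq> S)" for S
  obtain r where r: "r \<in> pverts T"
    using conn by (auto simp: connected_def strongly_connected_def)
  have "A {r} = {}"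
    using irr QT by (auto simp: A_def)
  then have base: "grown {r}"
    using r by (auto simp: grown_def apath_def awalk_def intro!: pendant_tree.single exI[of _ "[]"])
  have step: "\<exists>c\<in>pverts T - S. grown (insert c S)" if S: "grown S" "S \<noteq> pverts T" for S
  proof -
    \<comment> \<open>Without such an arc \<open>S\<close> would be closed under reachability, and
      connectedness would make it contain every vertex of \<open>T\<close>.\<close>
    obtain p c where pc: "p \<in> S" "c \<notin> S" "(p, c) \<in> parcs T"
    proof (rule ccontr)
      assume "\<not> thesis"
      then have closed: "\<And>p c. p \<in> S \<Longrightarrow> (p, c) \<in> parcs T \<Longrightarrow> c \<in> S"
        using that by blast
      obtain u v where u: "u \<in> S" and v: "v \<in> pverts T" "v \<notin> S"
        using S unfolding grown_def by blast
      have "u \<rightarrow>\<^sup>*\<^bsub>with_proj T\<^esub> v"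
        using conn u v(1) S by (auto simp: connected_def strongly_connected_def grown_def
            reachable_mk_symmetric_eq[OF pair_sym_arcs])
      then have "v \<in> S"
        by (induction rule: reachable_induct) (use u closed in auto)
      with v show False by simp
    qed
    have path: "\<exists>q. apath u q v \<and> set (pawalk_verts u q) \<subseteq> S" if "u \<in> S" "v \<in> S" for u v
      using S(1) that by (simp add: grown_def)
    have cT: "c \<in> pverts T"
      using pc in_arcsD2 by auto
    have cp: "(c, p) \<in> parcs T" using pc sym by blast
    have uniq: "p' = p" if p': "p' \<in> S" "(p', c) \<in> parcs T" for p'
    proof (rule ccontr)
      assume "p' \<noteq> p"
      obtain q where q: "apath p q p'" "set (pawalk_verts p q) \<subseteq> S"
        using path[OF pc(1) p'(1)] by blast
      \<comment> \<open>A nonempty \<open>q\<close> gives the closed walk through \<open>c\<close>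
        at least three arcs, as a contradiction to \<open>acyc\<close> requires; going back and
        forth along one edge has length 2 and is harmless.\<close>
      have "q \<noteq> []"
        using q \<open>p' \<noteq> p\<close> by (auto simp: apath_def awalk_def)
      have "awalk c ((c, p) # q @ [(p', c)]) c"
        using q(1) cT p' cp pcas_snoc[of p q p' c] by (auto simp: apath_def awalk_def)
      \<comment> \<open>The path \<open>q\<close> runs inside \<open>S\<close> and so avoids
        \<open>c\<close>; once the first vertex is dropped, \<open>c\<close> occurs only at the
        end.\<close>
      moreover have "distinct (tl (pawalk_verts c ((c, p) # q @ [(p', c)])))"
        using q pc pawalk_verts_snoc[of p q p' c] by (auto simp: apath_def awalk_def)
      ultimately have "cycle ((c, p) # q @ [(p', c)])"
        by (auto simp: cycle_def)
      then show False
        using acyc \<open>q \<noteq> []\<close> by (cases q) fastforce+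
    qed
    define e where "e = (if (p, c) \<in> parcs Q then (p, c) else (c, p))"
    have "A (insert c S) = insert e (A S)"
    proof -
      \<comment> \<open>Since \<open>p\<close> is the only neighbour of \<open>c\<close> in
        \<open>S\<close> and \<open>Q\<close> contains exactly one orientation of that edge, passing
        from \<open>S\<close> to \<open>insert c S\<close> adds just the arc
        \<open>e\<close>.\<close>
      have nbr: "x = p" if "x \<in> S" "(c, x) \<in> parcs Q \<or> (x, c) \<in> parcs Q" for x
        using that uniq QT sym by blast
      have "(c, c) \<notin> parcs Q"
        using irr QT by blast
      moreover have "(c, p) \<in> parcs Q \<longleftrightarrow> (p, c) \<notin> parcs Q"
        using QT1[OF pc(3)] by blast
      ultimately have "(x, y) \<in> A (insert c S) \<longleftrightarrow> (x, y) \<in> insert e (A S)" for x y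
        using pc(1) nbr[of x] nbr[of y] by (auto simp: A_def e_def)
      then show ?thesis by auto
    qed
    then have "pendant_tree (insert c S) (A (insert c S))"
      using S pc by (auto simp: grown_def e_def intro!: pendant_tree.pendant[of S "A S" p])
    moreover have "\<exists>q. apath u q v \<and> set (pawalk_verts u q) \<subseteq> insert c S"
      if uv: "u \<in> insert c S" "v \<in> insert c S" for u v
    proof -
      consider "u \<in> S" "v \<in> S" | "u = c" "v = c" | "u = c" "v \<in> S" | "u \<in> S" "v = c"
        using uv by blast
      then show ?thesis
      proof cases
        case 1
        then show ?thesis using path[of u v] by blast
      next
        case 2
        then show ?thesis
          using cT by (intro exI[of _ "[]"]) (auto simp: apath_def awalk_def)
      next
        case 3
        then obtain q where q: "apath p q v" "set (pawalk_verts p q) \<subseteq> S"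
          using path[of p v] pc by blast
        then show ?thesis
          using 3 pc cp cT by (intro exI[of _ "(c, p) # q"]) (auto simp: apath_def awalk_def)
      next
        case 4
        then obtain q where q: "apath u q p" "set (pawalk_verts u q) \<subseteq> S"
          using path[of u p] pc by blast
        then show ?thesis
          using 4 pc pawalk_verts_snoc[of u q p c] pcas_snoc[of u q p c]
          by (intro exI[of _ "q @ [(p, c)]"]) (auto simp: apath_def awalk_def)
      qed
    qed
    ultimately have "grown (insert c S)"
      using S cT by (auto simp: grown_def)
    then show ?thesis using cT pc by blast
  qed
  have "grown S \<Longrightarrow> grown (pverts T)" for S
  proof (induction "card (pverts T - S)" arbitrary: S rule: less_induct)
    case less
    show ?case
    proof (cases "S = pverts T")
      case False
      obtain c where c: "c \<in> pverts T - S" "grown (insert c S)"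
        using step[OF less.prems False] by blast
      have "card (pverts T - insert c S) < card (pverts T - S)"
        using c by (intro psubset_card_mono) auto
      then show ?thesis using less.hyps c by blast
    qed (use less in simp)
  qed
  then have "pendant_tree (pverts Q) (A (pverts Q))"
    using base QT by (auto simp: grown_def)
  moreover have "A (pverts Q) = parcs Q"
    using QT in_arcsD1 in_arcsD2 by (fastforce simp: A_def)
  ultimately show ?thesis by simp
qed

section \<open>Homomorphisms as a preorder on digraphs\<close>

lemma hom_to_iff:
  assumes "pair_wf_digraph G"
  shows "hom_to G H \<longleftrightarrow> (\<exists>f. (\<forall>u\<in>pverts G. f u \<in> pverts H) \<and>
    (\<forall>(u, v)\<in>parcs G. (f u, f v) \<in> parcs H))" (is "_ \<longleftrightarrow> (\<exists>f. ?P f)")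
proof
  assume "\<exists>f. ?P f"
  then obtain f where "?P f" ..
  then have "restrict f (pverts G) \<in> homs G H"
    using pair_wf_digraph.in_arcsD1[OF assms] pair_wf_digraph.in_arcsD2[OF assms]
    by (auto simp: homs_def)
  then show "hom_to G H" by (auto simp: hom_to_def)
qed (auto simp: hom_to_def homs_def)

lemma hom_to_refl: "pair_wf_digraph G \<Longrightarrow> hom_to G G"
  by (subst hom_to_iff) (auto intro: exI[of _ id])

lemma hom_to_trans:
  assumes "pair_wf_digraph G" "pair_wf_digraph H" "hom_to G H" "hom_to H K"
  shows "hom_to G K"
proof -
  obtain f g where 
    "\<forall>u\<in>pverts G. f u \<in> pverts H" "\<forall>(u, v)\<in>parcs G. (f u, f v) \<in> parcs H"
    "\<forall>u\<in>pverts H. g u \<in> pverts K" "\<forall>(u, v)\<in>parcs H. (g u, g v) \<in> parcs K"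
    using assms(3,4) unfolding hom_to_iff[OF assms(1)] hom_to_iff[OF assms(2)] by blast
  then show ?thesis
    unfolding hom_to_iff[OF assms(1)] by (intro exI[of _ "g \<circ> f"]) fastforce
qed

section \<open>Labellings tested on all copies of a tree, and the digraphs representing them\<close>

text \<open>Both kinds of labels are carried along: \<open>fv\<close> holds the initial labels when
  \<open>P\<close> is a vertex, \<open>fa\<close> when \<open>P\<close> is an arc, and the enriched
  labels of the induction always sit on vertices. \<open>C\<close> collects the conditions on single
  arcs.\<close>

definition labelling :: "'w set \<Rightarrow> 'z set \<Rightarrow> ('w \<Rightarrow> 'z \<Rightarrow> 'w \<Rightarrow> bool) \<Rightarrow> 'g pair_pre_digraph \<Rightarrow>
    ('g \<Rightarrow> 'w) \<Rightarrow> ('g \<times> 'g \<Rightarrow> 'z) \<Rightarrow> bool" where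
  "labelling W Z C G fv fa \<longleftrightarrow> (\<forall>u\<in>pverts G. fv u \<in> W) \<and>
     (\<forall>(u, v)\<in>parcs G. fa (u, v) \<in> Z \<and> C (fv u) (fa (u, v)) (fv v))"

text \<open>A copy is any homomorphic image, possibly not injective. The restrictions ensure that
  \<open>good\<close> sees nothing but the labels on the copy.\<close>

definition all_copies :: "'q set \<Rightarrow> ('q \<times> 'q) set \<Rightarrow>
    (('q \<Rightarrow> 'w) \<Rightarrow> ('q \<times> 'q \<Rightarrow> 'z) \<Rightarrow> bool) \<Rightarrow> 'g pair_pre_digraph \<Rightarrow>
    ('g \<Rightarrow> 'w) \<Rightarrow> ('g \<times> 'g \<Rightarrow> 'z) \<Rightarrow> bool" where
  "all_copies S A good G fv fa \<longleftrightarrow> (\<forall>h\<in>homs \<lparr>pverts = S, parcs = A\<rparr> G.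
     good (restrict (fv \<circ> h) S) (restrict (fa \<circ> map_prod h h) A))"

text \<open>Serves to code enriched labels by elements of \<open>'v\<close> again, so that the type
  of labels stays the same throughout the induction.\<close>

lemma finite_image_of_infinite_type:
  assumes "finite X"
  obtains W :: "'v::infinite set" and f where "finite W" "f ` W = X"
proof -
  obtain W :: "'v set" where W: "finite W" "card W = card X"
    using infinite_arbitrarily_large[OF infinite_UNIV] by blast
  then obtain f where "bij_betw f W X"
    using assms finite_same_card_bij by blast
  then show ?thesis
    using that W by (auto simp: bij_betw_def)
qed

text \<open>Removing a leaf replaces \<open>W\<close>, \<open>C\<close> and \<open>good\<close>, so
  the induction is carried out for arbitrary ones; \<open>Z\<close> and the arc labels stay fixed.
  The digraph \<open>D\<close> is chosen before \<open>G\<close>, as a right adjoint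
  demands.\<close>

lemma labelling_dual:
  fixes W :: "'v::infinite set" and Z :: "'z set"
    and good :: "('q \<Rightarrow> 'v) \<Rightarrow> ('q \<times> 'q \<Rightarrow> 'z) \<Rightarrow> bool"
  assumes "pendant_tree S A" "finite W" "finite Z"
  shows "\<exists>D :: 'v pair_pre_digraph. pair_fin_digraph D \<and>
    (\<forall>G :: 'g pair_pre_digraph. pair_fin_digraph G \<longrightarrow>
      (hom_to G D \<longleftrightarrow> (\<exists>fv fa. labelling W Z C G fv fa \<and> all_copies S A good G fv fa)))"
  using assms(1,2)
proof (induction arbitrary: W C good rule: pendant_tree.induct)
  case (single r)
  \<comment> \<open>A single vertex has no arcs, so the arc labelling restricted to the empty set is
    constantly \<open>undefined\<close> and \<open>good\<close> becomes a condition on one vertex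
    label.\<close>
  define V where "V = {w\<in>W. good (restrict (\<lambda>_. w) {r}) (\<lambda>_. undefined)}"
  define D where "D = \<lparr>pverts = V, parcs = {(w, w')\<in>V \<times> V. \<exists>z\<in>Z. C w z w'}\<rparr>"
  have "finite V"
    using single by (simp add: V_def)
  then have "pair_fin_digraph D"
    by unfold_locales (auto simp: D_def intro: finite_subset[of _ "V \<times> V"])
  moreover have "hom_to G D \<longleftrightarrow> (\<exists>fv fa. labelling W Z C G fv fa \<and> all_copies {r} {} good G fv fa)"
    if G: "pair_fin_digraph G" for G :: "'g pair_pre_digraph"
  proof -
    interpret G: pair_fin_digraph G by fact
    have empty: "restrict g {} = (\<lambda>_. undefined)" for g :: "'q \<times> 'q \<Rightarrow> 'z"
      by auto
    have copies: "all_copies {r} {} good G fv fa \<longleftrightarrow>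
        (\<forall>u\<in>pverts G. good (restrict (\<lambda>_. fv u) {r}) (\<lambda>_. undefined))" for fv fa
    proof
      assume *: "all_copies {r} {} good G fv fa"
      show "\<forall>u\<in>pverts G. good (restrict (\<lambda>_. fv u) {r}) (\<lambda>_. undefined)"
      proof
        fix u assume "u \<in> pverts G"
        then have "restrict (\<lambda>_. u) {r} \<in> homs \<lparr>pverts = {r}, parcs = {}\<rparr> G"
          by (auto simp: homs_def)
        with * have "good (restrict (fv \<circ> restrict (\<lambda>_. u) {r}) {r}) (\<lambda>_. undefined)"
          unfolding all_copies_def empty by blast
        moreover have "restrict (fv \<circ> restrict (\<lambda>_. u) {r}) {r} = restrict (\<lambda>_. fv u) {r}"
          by auto
        ultimately show "good (restrict (\<lambda>_. fv u) {r}) (\<lambda>_. undefined)"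
          by (simp only:)
      qed
    next
      assume *: "\<forall>u\<in>pverts G. good (restrict (\<lambda>_. fv u) {r}) (\<lambda>_. undefined)"
      show "all_copies {r} {} good G fv fa"
        unfolding all_copies_def
      proof
        fix h assume "h \<in> homs \<lparr>pverts = {r}, parcs = {}\<rparr> G"
        then have "h r \<in> pverts G" by (auto simp: homs_def)
        moreover have "restrict (fv \<circ> h) {r} = restrict (\<lambda>_. fv (h r)) {r}"
          by auto
        ultimately show "good (restrict (fv \<circ> h) {r}) (restrict (fa \<circ> map_prod h h) {})"
          using * by (simp only: empty)
      qed
    qed
    \<comment> \<open>Now arc labels are constrained one arc at a time, so they can be chosen
      independently and turn into the existential quantifier in the arcs of
      \<open>D\<close>.\<close>
    have "(\<exists>fa. labelling W Z C G fv fa \<and> all_copies {r} {} good G fv fa) \<longleftrightarrow>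
        (\<forall>u\<in>pverts G. fv u \<in> V) \<and> (\<forall>(u, v)\<in>parcs G. \<exists>z\<in>Z. C (fv u) z (fv v))" (is "?L \<longleftrightarrow> ?R") for fv
    proof
      assume ?R
      then show ?L
        by (intro exI[of _ "\<lambda>(u, v). SOME z. z \<in> Z \<and> C (fv u) z (fv v)"])
          (auto simp: labelling_def copies V_def some_eq_ex Bex_def split: prod.splits
            intro: someI2_ex)
    qed (auto simp: labelling_def copies V_def)
    then show ?thesis
      unfolding hom_to_iff[OF G.pair_wf_digraph_axioms]
      using G.in_arcsD1 G.in_arcsD2 by (auto simp: D_def split: prod.splits; blast)
  qed
  ultimately show ?case by blast
next
  case (pendant S A p c e)
  note A = pendant_tree_arcs[OF pendant.hyps(1)]
  define fwd where "fwd \<longleftrightarrow> e = (p, c)"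
  \<comment> \<open>\<open>dir\<close> and \<open>dirG\<close> are the same map, needed at two
    types: it takes (attachment vertex, leaf) to the arc as oriented by \<open>e\<close>.\<close>
  define dir :: "'q \<times> 'q \<Rightarrow> 'q \<times> 'q" where "dir = (if fwd then id else prod.swap)"
  define dirG :: "'g \<times> 'g \<Rightarrow> 'g \<times> 'g" where "dirG = (if fwd then id else prod.swap)"
  have e: "e = dir (p, c)"
    using pendant.hyps by (auto simp: dir_def fwd_def)
  \<comment> \<open>An enriched label is an old label with a stored set of pairs (neighbour label,
    arc label). Elements of \<open>W'\<close> code these, and \<open>f\<close> decodes them.\<close>
  have "finite (W \<times> Pow (W \<times> Z))"
    using pendant.prems assms(3) by simp
  then obtain W' :: "'v set" and f :: "'v \<Rightarrow> 'v \<times> ('v \<times> 'z) set"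
    where W': "finite W'" "f ` W' = W \<times> Pow (W \<times> Z)"
    by (rule finite_image_of_infinite_type)
  define lab where "lab = fst \<circ> f"
  define nbs where "nbs = snd \<circ> f"
  text \<open>The stored set may be larger than the set of pairs that occur; an equality could not be
    imposed arc by arc.\<close>
  define C' where "C' i z j \<longleftrightarrow> C (lab i) z (lab j) \<and>
    (if fwd then (lab j, z) \<in> nbs i else (lab i, z) \<in> nbs j)" for i z j
  \<comment> \<open>Each pair stored at \<open>p\<close> is a candidate for the label
    \<open>w\<close> of the leaf \<open>c\<close> and the label \<open>z\<close> of the arc
    \<open>e\<close>; all candidates must pass.\<close>
  define good' where "good' lv la \<longleftrightarrow>
    (\<forall>(w, z)\<in>nbs (lv p). good ((restrict (lab \<circ> lv) S)(c := w)) (la(e := z)))" for lv la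
  have labW: "lab i \<in> W" if "i \<in> W'" for i
  proof -
    have "f i \<in> W \<times> Pow (W \<times> Z)"
      using that W'(2) by blast
    then show ?thesis by (auto simp: lab_def)
  qed
  obtain D :: "'v pair_pre_digraph" where D: "pair_fin_digraph D"
    "\<And>G :: 'g pair_pre_digraph. pair_fin_digraph G \<Longrightarrow>
      hom_to G D \<longleftrightarrow> (\<exists>fv fa. labelling W' Z C' G fv fa \<and> all_copies S A good' G fv fa)"
    using pendant.IH[OF W'(1), of C' good'] by blast
  have "(\<exists>fv fa. labelling W' Z C' G fv fa \<and> all_copies S A good' G fv fa) \<longleftrightarrow>
      (\<exists>fv fa. labelling W Z C G fv fa \<and> all_copies (insert c S) (insert e A) good G fv fa)"
    (is "?L \<longleftrightarrow> ?R") if G: "pair_fin_digraph G" for G :: "'g pair_pre_digraph"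
  proof -
    interpret G: pair_fin_digraph G by fact
    show ?thesis
    proof
      assume ?L
      then obtain fv fa where lab: "labelling W' Z C' G fv fa" and copies: "all_copies S A good' G fv fa"
        by blast
      have "labelling W Z C G (lab \<circ> fv) fa"
        using lab labW by (auto simp: labelling_def C'_def)
      moreover have "all_copies (insert c S) (insert e A) good G (lab \<circ> fv) fa"
        unfolding all_copies_def
      proof
        fix h assume h: "h \<in> homs \<lparr>pverts = insert c S, parcs = insert e A\<rparr> G"
        let ?h = "restrict h S"
        have "?h \<in> homs \<lparr>pverts = S, parcs = A\<rparr> G"
          using h A by (auto simp: homs_def)
        then have g: "good' (restrict (fv \<circ> ?h) S) (restrict (fa \<circ> map_prod ?h ?h) A)"
          using copies by (auto simp: all_copies_def)
        have "map_prod h h e \<in> parcs G"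
          using h by (auto simp: homs_def split: prod.splits)
        \<comment> \<open>By \<open>C'\<close> the labels actually found at the leaf are among the
          pairs stored at \<open>h p\<close>, so \<open>good'\<close> on the smaller copy covers
          them.\<close>
        then have "(lab (fv (h c)), fa (map_prod h h e)) \<in> nbs (fv (h p))"
          using lab by (auto simp: labelling_def C'_def e dir_def split: if_splits)
        moreover have "(restrict (lab \<circ> restrict (fv \<circ> ?h) S) S)(c := lab (fv (h c))) =
            restrict (lab \<circ> fv \<circ> h) (insert c S)"
          using pendant.hyps by (auto simp: restrict_def)
        moreover have "(restrict (fa \<circ> map_prod ?h ?h) A)(e := fa (map_prod h h e)) =
            restrict (fa \<circ> map_prod h h) (insert e A)"
          using A by (auto simp: restrict_def fun_eq_iff)
        ultimately show "good (restrict (lab \<circ> fv \<circ> h) (insert c S))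
            (restrict (fa \<circ> map_prod h h) (insert e A))"
          using g pendant.hyps by (force simp: good'_def)
      qed
      ultimately show ?R by blast
    next
      assume ?R
      then obtain fv fa where lab: "labelling W Z C G fv fa"
        and copies: "all_copies (insert c S) (insert e A) good G fv fa"
        by blast
      \<comment> \<open>For the converse exactly the occurring pairs are stored: \<open>C'\<close>
        then holds, and every stored pair comes from a real arc of \<open>G\<close>.\<close>
      define E where "E u = {(fv u', fa (dirG (u, u'))) | u'. dirG (u, u') \<in> parcs G}" for u
      define fv' where "fv' u = (SOME i. i \<in> W' \<and> f i = (fv u, E u))" for u
      have fv': "fv' u \<in> W'" "lab (fv' u) = fv u" "nbs (fv' u) = E u" if "u \<in> pverts G" for u
      proof -
        have "(fv u', fa (dirG (u, u'))) \<in> W \<times> Z" if "dirG (u, u') \<in> parcs G" for u'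
          using lab that G.in_arcsD1[of u' u] G.in_arcsD2[of u u']
          by (auto simp: labelling_def dirG_def split: if_splits)
        then have "(fv u, E u) \<in> W \<times> Pow (W \<times> Z)"
          using lab that by (auto simp: labelling_def E_def)
        then have "\<exists>i. i \<in> W' \<and> f i = (fv u, E u)"
          unfolding W'(2)[symmetric] by force
        then have "fv' u \<in> W' \<and> f (fv' u) = (fv u, E u)"
          unfolding fv'_def by (rule someI_ex)
        then show "fv' u \<in> W'" "lab (fv' u) = fv u" "nbs (fv' u) = E u"
          by (auto simp: lab_def nbs_def)
      qed
      have "labelling W' Z C' G fv' fa"
        unfolding labelling_def
      proof (intro conjI ballI; clarify?)
        fix u v assume uv: "(u, v) \<in> parcs G"
        then have "u \<in> pverts G" "v \<in> pverts G"
          by (auto dest: G.in_arcsD1 G.in_arcsD2)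
        then have "C' (fv' u) (fa (u, v)) (fv' v)"
          using lab uv fv'[of u] fv'[of v] by (auto simp: C'_def E_def dirG_def labelling_def)
        then show "fa (u, v) \<in> Z \<and> C' (fv' u) (fa (u, v)) (fv' v)"
          using lab uv by (auto simp: labelling_def)
      qed (rule fv')
      moreover have "all_copies S A good' G fv' fa"
        unfolding all_copies_def good'_def
      proof (intro ballI, clarify)
        fix h w z
        assume h: "h \<in> homs \<lparr>pverts = S, parcs = A\<rparr> G"
          and wz: "(w, z) \<in> nbs (restrict (fv' \<circ> h) S p)"
        have hS: "h x \<in> pverts G" if "x \<in> S" for x
          using h that by (auto simp: homs_def)
        \<comment> \<open>The vertex \<open>u\<close> realising the stored pair is where the leaf
          \<open>c\<close> is sent, which extends \<open>h\<close> to a copy of the larger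
          tree.\<close>
        obtain u where u: "w = fv u" "z = fa (dirG (h p, u))" "dirG (h p, u) \<in> parcs G"
          using wz pendant.hyps hS fv' by (auto simp: E_def)
        let ?h = "h(c := u)"
        have uG: "u \<in> pverts G"
          using u G.in_arcsD1 G.in_arcsD2 by (auto simp: dirG_def split: if_splits)
        have me: "map_prod ?h ?h e = dirG (h p, u)"
          using pendant.hyps by (auto simp: e dir_def dirG_def)
        have "?h \<in> homs \<lparr>pverts = insert c S, parcs = insert e A\<rparr> G"
        proof -
          have "?h \<in> insert c S \<rightarrow>\<^sub>E pverts G"
            using h uG by (auto simp: homs_def PiE_def extensional_def)
          moreover have "map_prod ?h ?h a \<in> parcs G" if "a \<in> insert e A" for a
            using that h u me A pendant.hyps(3) by (cases a) (auto simp: homs_def)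
          ultimately show ?thesis by (fastforce simp: homs_def)
        qed
        then have "good (restrict (fv \<circ> ?h) (insert c S)) (restrict (fa \<circ> map_prod ?h ?h) (insert e A))"
          using copies by (auto simp: all_copies_def)
        moreover have "restrict (fv \<circ> ?h) (insert c S) =
            (restrict (lab \<circ> restrict (fv' \<circ> h) S) S)(c := w)"
          using pendant.hyps hS fv' u by (auto simp: restrict_def)
        moreover have "restrict (fa \<circ> map_prod ?h ?h) (insert e A) =
            (restrict (fa \<circ> map_prod h h) A)(e := z)"
          using A pendant.hyps(3) me u by (fastforce simp: restrict_def fun_eq_iff)
        ultimately show "good ((restrict (lab \<circ> restrict (fv' \<circ> h) S) S)(c := w))
            ((restrict (fa \<circ> map_prod h h) A)(e := z))"
          by simp
      qed
      ultimately show ?L by blast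
    qed
  qed
  then show ?case using D by blast
qed

section \<open>Homomorphisms out of the central Pultr functor as labellings\<close>

lemma digraph_iso_dipath0:
  assumes "digraph_iso (with_proj dipath0) (with_proj P)"
  obtains x where "P = \<lparr>pverts = {x}, parcs = {}\<rparr>"
proof -
  obtain f where f: "with_proj P = app_iso f (with_proj dipath0)"
    using assms by (auto simp: digraph_iso_def)
  have "pverts P = {iso_verts f 0}" "parcs P = {}"
    using arg_cong[OF f, of verts] arg_cong[OF f, of arcs] by (simp_all add: dipath0_def)
  then show thesis
    by (intro that[of "iso_verts f 0"] pair_pre_digraph.equality) simp_all
qed

lemma digraph_iso_dipath1:
  assumes "digraph_iso (with_proj dipath1) (with_proj P)"
  obtains x y where "x \<noteq> y" "P = \<lparr>pverts = {x, y}, parcs = {(x, y)}\<rparr>"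
proof -
  obtain f where iso: "pre_digraph.digraph_isomorphism (with_proj dipath1) f"
    and f: "with_proj P = app_iso f (with_proj dipath1)"
    using assms by (auto simp: digraph_iso_def)
  let ?x = "iso_verts f 0" and ?y = "iso_verts f 1"
  have V: "pverts P = {?x, ?y}" and A: "parcs P = {iso_arcs f (0, 1)}"
    and tail: "iso_tail f = fst" and head: "iso_head f = snd"
    using arg_cong[OF f, of verts] arg_cong[OF f, of arcs]
      arg_cong[OF f, of tail] arg_cong[OF f, of head]
    by (simp_all add: dipath1_def)
  \<comment> \<open>The incidence maps of \<open>with_proj P\<close> are the projections, so the
    image arc is the pair of the images of its ends.\<close>
  have "?x \<noteq> ?y" and "fst (iso_arcs f (0, 1)) = ?x" "snd (iso_arcs f (0, 1)) = ?y"
    using iso tail head by (auto simp: pre_digraph.digraph_isomorphism_def dipath1_def)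
  then show thesis
    using V A that[of ?x ?y] by (metis pair_pre_digraph.surjective prod.collapse unit.exhaust)
qed

text \<open>Vertices of \<Gamma>(G) are the vertices or the arcs of \<open>G\<close>, so a map to
  \<open>H\<close> is a labelling with trivial \<open>C\<close>; \<open>good\<close> asks that the
  labels at the two images of \<open>P\<close> in \<open>Q\<close> form an arc of
  \<open>H\<close>.\<close>

lemma central_pultr_dual:
  fixes H :: "'v::infinite pair_pre_digraph"
  assumes "pultr_template P Q \<epsilon>\<^sub>1 \<epsilon>\<^sub>2"
    and P: "digraph_iso (with_proj dipath0) (with_proj P) \<or> digraph_iso (with_proj dipath1) (with_proj P)"
    and Q: "oriented_tree Q" and H: "pair_fin_digraph H"
  shows "\<exists>D :: 'v pair_pre_digraph. pair_fin_digraph D \<and> (\<forall>G :: 'v pair_pre_digraph.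
    pair_fin_digraph G \<longrightarrow> (hom_to (central_pultr P Q \<epsilon>\<^sub>1 \<epsilon>\<^sub>2 G) H \<longleftrightarrow> hom_to G D))"
proof -
  have finP: "pair_fin_digraph P" and \<epsilon>: "\<epsilon>\<^sub>1 \<in> homs P Q" "\<epsilon>\<^sub>2 \<in> homs P Q"
    using assms(1) by (auto simp: pultr_template_def)
  have finH: "finite (pverts H)"
    using H by (rule pair_fin_digraph.pair_finite_verts)
  have Q_eq: "\<lparr>pverts = pverts Q, parcs = parcs Q\<rparr> = Q"
    by simp
  note dual = labelling_dual[OF oriented_tree_pendant_tree[OF Q], where 'g = 'v and 'v = 'v and 'z = 'v,
      unfolded all_copies_def Q_eq]
  \<comment> \<open>Arcs of \<Gamma>(G) are replaced by the homomorphisms \<open>h\<close> that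
    witness them; both composites are automatically vertices.\<close>
  have hom_iff: "hom_to (central_pultr P Q \<epsilon>\<^sub>1 \<epsilon>\<^sub>2 G) H \<longleftrightarrow>
      (\<exists>F. (\<forall>g\<in>homs P G. F g \<in> pverts H) \<and> (\<forall>h\<in>homs Q G.
        (F (compose (pverts P) h \<epsilon>\<^sub>1), F (compose (pverts P) h \<epsilon>\<^sub>2)) \<in> parcs H))"
    if "pair_fin_digraph G" for G :: "'v pair_pre_digraph"
  proof -
    have "compose (pverts P) h \<epsilon> \<in> homs P G" if "h \<in> homs Q G" "\<epsilon> \<in> homs P Q" for h \<epsilon>
      using that pair_wf_digraph.in_arcsD1[of P] pair_wf_digraph.in_arcsD2[of P] finP
      unfolding pair_fin_digraph_def
      by (fastforce simp: homs_def compose_def)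
    moreover have "pair_wf_digraph (central_pultr P Q \<epsilon>\<^sub>1 \<epsilon>\<^sub>2 G)"
      using pair_fin_digraph_central_pultr[OF finP that] unfolding pair_fin_digraph_def by blast
    ultimately show ?thesis
      using \<epsilon> by (subst hom_to_iff) (auto simp: central_pultr_def, blast+)
  qed
  from P show ?thesis
  proof
    assume "digraph_iso (with_proj dipath0) (with_proj P)"
    then obtain x where P: "P = \<lparr>pverts = {x}, parcs = {}\<rparr>"
      by (rule digraph_iso_dipath0)
    have x: "\<epsilon>\<^sub>1 x \<in> pverts Q" "\<epsilon>\<^sub>2 x \<in> pverts Q"
      using \<epsilon> by (auto simp: P homs_def)
    \<comment> \<open>Here vertices of \<open>G\<close> carry the labels; the one-element set
      \<open>{undefined}\<close> makes the arc labels void.\<close>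
    define good :: "('b \<Rightarrow> 'v) \<Rightarrow> ('b \<times> 'b \<Rightarrow> 'v) \<Rightarrow> bool"
      where "good lv la \<longleftrightarrow> (lv (\<epsilon>\<^sub>1 x), lv (\<epsilon>\<^sub>2 x)) \<in> parcs H" for lv la
    obtain D :: "'v pair_pre_digraph" where D: "pair_fin_digraph D"
      "\<And>G :: 'v pair_pre_digraph. pair_fin_digraph G \<Longrightarrow> hom_to G D \<longleftrightarrow>
        (\<exists>fv fa. labelling (pverts H) {undefined} (\<lambda>_ _ _. True) G fv fa \<and>
          (\<forall>h\<in>homs Q G. good (restrict (fv \<circ> h) (pverts Q)) (restrict (fa \<circ> map_prod h h) (parcs Q))))"
      using dual[OF finH, of "{undefined}" "\<lambda>_ _ _. True" good] by blast
    show ?thesis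
    proof (intro exI[of _ D] conjI allI impI D(1))
      fix G :: "'v pair_pre_digraph" assume G: "pair_fin_digraph G"
      show "hom_to (central_pultr P Q \<epsilon>\<^sub>1 \<epsilon>\<^sub>2 G) H \<longleftrightarrow> hom_to G D"
        unfolding hom_iff[OF G] D(2)[OF G]
      proof (safe)
        fix F assume F: "\<forall>g\<in>homs P G. F g \<in> pverts H"
          "\<forall>h\<in>homs Q G. (F (compose (pverts P) h \<epsilon>\<^sub>1), F (compose (pverts P) h \<epsilon>\<^sub>2)) \<in> parcs H"
        show "\<exists>fv fa. labelling (pverts H) {undefined} (\<lambda>_ _ _. True) G fv fa \<and>
          (\<forall>h\<in>homs Q G. good (restrict (fv \<circ> h) (pverts Q)) (restrict (fa \<circ> map_prod h h) (parcs Q)))"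
        proof (intro exI conjI ballI)
          show "labelling (pverts H) {undefined} (\<lambda>_ _ _. True) G
              (\<lambda>u. F (restrict (\<lambda>_. u) {x})) (\<lambda>_. undefined)"
            using F(1) by (auto simp: labelling_def P homs_def)
          fix h assume "h \<in> homs Q G"
          then show "good (restrict ((\<lambda>u. F (restrict (\<lambda>_. u) {x})) \<circ> h) (pverts Q))
              (restrict ((\<lambda>_. undefined) \<circ> map_prod h h) (parcs Q))"
            using F(2) x by (auto simp: good_def P compose_def restrict_def cong: if_cong)
        qed
      next
        fix fv fa assume "labelling (pverts H) {undefined} (\<lambda>_ _ _. True) G fv fa"
          "\<forall>h\<in>homs Q G. good (restrict (fv \<circ> h) (pverts Q)) (restrict (fa \<circ> map_prod h h) (parcs Q))"
        then show "\<exists>F. (\<forall>g\<in>homs P G. F g \<in> pverts H) \<and> (\<forall>h\<in>homs Q G.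
            (F (compose (pverts P) h \<epsilon>\<^sub>1), F (compose (pverts P) h \<epsilon>\<^sub>2)) \<in> parcs H)"
          using x by (intro exI[of _ "\<lambda>g. fv (g x)"])
            (auto simp: labelling_def good_def P compose_def homs_def)
      qed
    qed
  next
    assume "digraph_iso (with_proj dipath1) (with_proj P)"
    then obtain x y where xy: "x \<noteq> y" and P: "P = \<lparr>pverts = {x, y}, parcs = {(x, y)}\<rparr>"
      by (rule digraph_iso_dipath1)
    have xyQ: "(\<epsilon>\<^sub>1 x, \<epsilon>\<^sub>1 y) \<in> parcs Q" "(\<epsilon>\<^sub>2 x, \<epsilon>\<^sub>2 y) \<in> parcs Q"
      using \<epsilon> by (auto simp: P homs_def)
    \<comment> \<open>The roles are exchanged: arcs carry labels from \<open>H\<close>, and vertices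
      start with a dummy label.\<close>
    define good :: "('b \<Rightarrow> 'v) \<Rightarrow> ('b \<times> 'b \<Rightarrow> 'v) \<Rightarrow> bool"
      where "good lv la \<longleftrightarrow> (la (\<epsilon>\<^sub>1 x, \<epsilon>\<^sub>1 y), la (\<epsilon>\<^sub>2 x, \<epsilon>\<^sub>2 y)) \<in> parcs H" for lv la
    obtain D :: "'v pair_pre_digraph" where D: "pair_fin_digraph D"
      "\<And>G :: 'v pair_pre_digraph. pair_fin_digraph G \<Longrightarrow> hom_to G D \<longleftrightarrow>
        (\<exists>fv fa. labelling {undefined} (pverts H) (\<lambda>_ _ _. True) G fv fa \<and>
          (\<forall>h\<in>homs Q G. good (restrict (fv \<circ> h) (pverts Q)) (restrict (fa \<circ> map_prod h h) (parcs Q))))"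
      using dual[OF _ finH, of "{undefined}" "\<lambda>_ _ _. True" good] by blast
    show ?thesis
    proof (intro exI[of _ D] conjI allI impI D(1))
      fix G :: "'v pair_pre_digraph" assume G: "pair_fin_digraph G"
      then interpret G: pair_fin_digraph G .
      show "hom_to (central_pultr P Q \<epsilon>\<^sub>1 \<epsilon>\<^sub>2 G) H \<longleftrightarrow> hom_to G D"
        unfolding hom_iff[OF G] D(2)[OF G]
      proof (safe)
        fix F assume F: "\<forall>g\<in>homs P G. F g \<in> pverts H"
          "\<forall>h\<in>homs Q G. (F (compose (pverts P) h \<epsilon>\<^sub>1), F (compose (pverts P) h \<epsilon>\<^sub>2)) \<in> parcs H"
        \<comment> \<open>Inverse of the correspondence sending \<open>g\<close> to
          \<open>(g x, g y)\<close>; \<open>x \<noteq> y\<close> lets the two ends be prescribed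
          separately.\<close>
        define arc where "arc = (\<lambda>(u, v). restrict (\<lambda>t. if t = x then u else v) {x, y} :: 'a \<Rightarrow> 'v)"
        have arc: "arc a \<in> homs P G" if "a \<in> parcs G" for a
          using that xy G.in_arcsD1 G.in_arcsD2 by (cases a) (auto simp: arc_def homs_def P)
        have compose: "compose (pverts P) h \<epsilon> = arc (h (\<epsilon> x), h (\<epsilon> y))" for h \<epsilon>
          using xy by (auto simp: arc_def compose_def P restrict_def)
        have "\<forall>h\<in>homs Q G.
            (F (arc (h (\<epsilon>\<^sub>1 x), h (\<epsilon>\<^sub>1 y))), F (arc (h (\<epsilon>\<^sub>2 x), h (\<epsilon>\<^sub>2 y)))) \<in> parcs H"
          using F(2) unfolding compose .
        with arc show "\<exists>fv fa. labelling {undefined} (pverts H) (\<lambda>_ _ _. True) G fv fa \<and>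
          (\<forall>h\<in>homs Q G. good (restrict (fv \<circ> h) (pverts Q)) (restrict (fa \<circ> map_prod h h) (parcs Q)))"
          using F(1) xyQ by (intro exI[of _ "\<lambda>_ :: 'v. undefined"] exI[of _ "F \<circ> arc"])
            (auto simp: labelling_def good_def)
      next
        fix fv fa assume "labelling {undefined} (pverts H) (\<lambda>_ _ _. True) G fv fa"
          "\<forall>h\<in>homs Q G. good (restrict (fv \<circ> h) (pverts Q)) (restrict (fa \<circ> map_prod h h) (parcs Q))"
        then show "\<exists>F. (\<forall>g\<in>homs P G. F g \<in> pverts H) \<and> (\<forall>h\<in>homs Q G.
            (F (compose (pverts P) h \<epsilon>\<^sub>1), F (compose (pverts P) h \<epsilon>\<^sub>2)) \<in> parcs H)"
          using xyQ by (intro exI[of _ "\<lambda>g. fa (g x, g y)"])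
            (auto simp: labelling_def good_def P compose_def homs_def)
      qed
    qed
  qed
qed

section \<open>The right adjoint and its functoriality\<close>

theorem theorem7p1:
  fixes P :: "'p pair_pre_digraph" and Q :: "'q pair_pre_digraph"
    and \<epsilon>\<^sub>1 \<epsilon>\<^sub>2 :: "'p \<Rightarrow> 'q"
  assumes "pultr_template P Q \<epsilon>\<^sub>1 \<epsilon>\<^sub>2"
    and "digraph_iso (with_proj dipath0) (with_proj P) \<or> digraph_iso (with_proj dipath1) (with_proj P)"
    and "oriented_tree Q"
  shows "\<exists>\<Omega> :: 'v::infinite pair_pre_digraph \<Rightarrow> 'v pair_pre_digraph.
    digraph_functor \<Omega> \<and>
    (\<forall>(G :: 'v pair_pre_digraph) (H :: 'v pair_pre_digraph).
      pair_fin_digraph G \<longrightarrow> pair_fin_digraph H \<longrightarrow>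
      (hom_to (central_pultr P Q \<epsilon>\<^sub>1 \<epsilon>\<^sub>2 G) H \<longleftrightarrow> hom_to G (\<Omega> H)))"
proof -
  let ?\<Gamma> = "central_pultr P Q \<epsilon>\<^sub>1 \<epsilon>\<^sub>2 :: 'v pair_pre_digraph \<Rightarrow> _"
  obtain \<Omega> :: "'v pair_pre_digraph \<Rightarrow> 'v pair_pre_digraph" where \<Omega>:
    "\<And>H. pair_fin_digraph H \<Longrightarrow> pair_fin_digraph (\<Omega> H)"
    "\<And>G H. pair_fin_digraph G \<Longrightarrow> pair_fin_digraph H \<Longrightarrow> hom_to (?\<Gamma> G) H \<longleftrightarrow> hom_to G (\<Omega> H)"
    using central_pultr_dual[OF assms, where 'v = 'v] by metis
  have wf: "pair_wf_digraph G" if "pair_fin_digraph G" for G :: "'x pair_pre_digraph"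
    using that by (simp add: pair_fin_digraph_def)
  \<comment> \<open>Functoriality follows from the equivalence: the identity of \<Omega>(G) yields
    \<Gamma>(\<Omega>(G)) \<rightarrow> G, this is composed with G \<rightarrow> H, and the result
    is transferred back.\<close>
  have "hom_to (\<Omega> G) (\<Omega> H)"
    if G: "pair_fin_digraph G" and H: "pair_fin_digraph H" and GH: "hom_to G H" for G H
  proof -
    have "hom_to (?\<Gamma> (\<Omega> G)) G"
      using \<Omega> G hom_to_refl wf by blast
    moreover have "pair_fin_digraph (?\<Gamma> (\<Omega> G))"
      using assms(1) \<Omega>(1)[OF G]
      by (auto simp: pultr_template_def intro: pair_fin_digraph_central_pultr)
    ultimately have "hom_to (?\<Gamma> (\<Omega> G)) H"
      using hom_to_trans G GH pair_fin_digraph_def by metis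
    then show ?thesis
      using \<Omega> G H by blast
  qed
  then have "digraph_functor \<Omega>"
    using \<Omega>(1) by (simp add: digraph_functor_def)
  then show ?thesis
    using \<Omega>(2) by blast
qed

end
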